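(* There exist at least $$\frac{1}{8n^2\sqrt{3}}\,e^{\pi\sqrt{2n/3}}\,(1+o(1))$$ pairwise nonequivalent propelinear extended perfect binary codes of length $4n$, as $n$ goes to infinity ($n$ ranging over the powers of $2$).
   Context: A binary code $C\subseteq\mathbb{F}_2^N$ is propelinear if to each $x\in C$ one can assign a permutation $\pi_x$ of the $N$ coordinates, acting by $\pi(x_1,\ldots,x_N)=(x_{\pi^{-1}(1)},\ldots,x_{\pi^{-1}(N)})$, such that (i) $x+\pi_x(C)=C$ for every $x\in C$; and (ii) for all $x,y\in C$, if $z=x+\pi_x(y)$ then $\pi_z=\pi_x\circ\pi_y$. An extended perfect binary code is a code obtained from a perfect binary code with minimum distance $3$ by appending an overall parity check. Two binary codes of length $N$ are equivalent if some isometry of the Hamming space $\mathbb{F}_2^N$ (a coordinate permutation followed by a translation) maps one onto the other. *)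

theory Defs
  imports
    Complex_Main
    "HOL-Library.Z2"
    "HOL-Combinatorics.Permutations"
    "Jordan_Normal_Form.Matrix"
begin

text \<open>
  The space of binary words of length \<open>N\<close> is \<open>carrier_vec N :: bit vec set\<close>;
  coordinates are numbered from \<open>0\<close> to \<open>N - 1\<close>.
\<close>

definition permute_coords :: "(nat \<Rightarrow> nat) \<Rightarrow> bit vec \<Rightarrow> bit vec" where
  "permute_coords \<sigma> x = vec (dim_vec x) (\<lambda>i. x $ (Hilbert_Choice.inv \<sigma> i))"

definition hamming_dist :: "bit vec \<Rightarrow> bit vec \<Rightarrow> nat" where
  "hamming_dist x y = card {i. i < dim_vec x \<and> x $ i \<noteq> y $ i}"

text \<open>
  The infimum of the empty set of natural numbers is \<open>0\<close>, so codes with fewer than two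
  words have minimum distance \<open>0\<close>.
\<close>

definition min_distance :: "bit vec set \<Rightarrow> nat" where
  "min_distance C = Inf {hamming_dist x y |x y. x \<in> C \<and> y \<in> C \<and> x \<noteq> y}"

text \<open>
  A code of minimum distance \<open>d\<close> is perfect if the balls of radius \<open>(d - 1) div 2\<close> around
  its words partition the space.
\<close>

definition perfect_code :: "nat \<Rightarrow> nat \<Rightarrow> bit vec set \<Rightarrow> bool" where
  "perfect_code N d C \<longleftrightarrow>
     C \<subseteq> carrier_vec N \<and> min_distance C = d \<and>
     (\<forall>y\<in>carrier_vec N. \<exists>!x. x \<in> C \<and> hamming_dist x y \<le> (d - 1) div 2)"

definition append_parity :: "bit vec \<Rightarrow> bit vec" where
  "append_parity x = x @\<^sub>v vec 1 (\<lambda>_. \<Sum>i<dim_vec x. x $ i)"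

definition extended_perfect_code :: "nat \<Rightarrow> bit vec set \<Rightarrow> bool" where
  "extended_perfect_code N C \<longleftrightarrow>
     (\<exists>m C'. N = m + 1 \<and> perfect_code m 3 C' \<and> C = append_parity ` C')"

definition propelinear :: "nat \<Rightarrow> bit vec set \<Rightarrow> bool" where
  "propelinear N C \<longleftrightarrow>
     C \<subseteq> carrier_vec N \<and>
     (\<exists>\<pi>. (\<forall>x\<in>C. \<pi> x permutes {..<N}) \<and>
          (\<forall>x\<in>C. (\<lambda>y. x + permute_coords (\<pi> x) y) ` C = C) \<and>
          (\<forall>x\<in>C. \<forall>y\<in>C. \<pi> (x + permute_coords (\<pi> x) y) = \<pi> x \<circ> \<pi> y))"

definition equivalent_codes :: "nat \<Rightarrow> bit vec set \<Rightarrow> bit vec set \<Rightarrow> bool" where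
  "equivalent_codes N C D \<longleftrightarrow>
     (\<exists>\<sigma> a. \<sigma> permutes {..<N} \<and> a \<in> carrier_vec N \<and>
            (\<lambda>x. a + permute_coords \<sigma> x) ` C = D)"

end

(*
  Vasil'ev's switching construction with a quadratic switching function (after Krotov and
  Potapov): let H be the extended Hamming code of length M = 2n, and let C_q consist of the words
  (u + c | u) with c in H and |u| = q(c) mod 2. This is an extended perfect code for every
  function q on H with values in F_2. If q is quadratic, then q(c + d) + q(c) + q(d) = <A c, d>
  with A linear, and the permutation pi_x for x = (u + c | u) exchanges the coordinates i and
  M + i whenever (A c)_i = 1: this changes the parity of the right half of a word with H-part d
  by <A c, d>, exactly as needed for x + pi_x(C_q) = C_q.

  Quadratic forms with monomials from a product of two disjoint sets of n/2 coordinates, both in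
  the upper half of the M coordinates, are separated by words of H, so there are 2^(n^2/4)
  distinct codes of this kind. An equivalence class has at most (4n)! 2^(4n) members, and the
  quotient exceeds the required bound for all large n; hence epsilon can be chosen to be 0 there,
  and -1 (with S empty) elsewhere.
*)
theory Submission
  imports Defs "HOL-Real_Asymp.Real_Asymp"
begin

text \<open>By default \<open>+\<close> and \<open>*\<close> on \<open>bit\<close> are rewritten to bitwise operations, which blocks ring reasoning.\<close>

declare add_bit_eq_xor [simp del] mult_bit_eq_and [simp del]

section \<open>Bits, Hamming distance and perfect codes of minimum distance 3\<close>

lemma bit_add_self [simp]: "a + a = 0" "a + (a + b) = b" for a b :: bit
  by (cases a; cases b; simp)+

lemma bit_add_eq_0_iff [simp]: "a + b = 0 \<longleftrightarrow> a = b" for a b :: bit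
  by (cases a; cases b; simp)

lemma bit_add_eq_1_iff [simp]: "a + b = 1 \<longleftrightarrow> a \<noteq> b" for a b :: bit
  by (cases a; cases b; simp)

lemma unit_vec_add_cancel [simp]:
  assumes "x \<in> carrier_vec N"
  shows "x + unit_vec N q + unit_vec N q = (x :: bit vec)"
  using assms by (intro eq_vecI) auto

lemma hamming_dist_le_1D:
  assumes x: "x \<in> carrier_vec m" and y: "y \<in> carrier_vec m" and "hamming_dist x y \<le> 1"
  shows "y = x \<or> (\<exists>q<m. y = x + unit_vec m q)"
proof -
  let ?D = "{i. i < dim_vec x \<and> x $ i \<noteq> y $ i}"
  have "card ?D = 0 \<or> card ?D = 1" using assms(3) unfolding hamming_dist_def by linarith
  then consider "?D = {}" | q where "?D = {q}" by (auto simp: card_1_singleton_iff)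
  then show ?thesis
  proof cases
    case 1
    then have "y = x" using x y by (intro eq_vecI) auto
    then show ?thesis ..
  next
    case (2 q)
    have "q < m" using 2 x by auto
    moreover have "y = x + unit_vec m q"
    proof (rule eq_vecI)
      fix i assume "i < dim_vec (x + unit_vec m q)"
      then have i: "i < m" by auto
      have "x $ i \<noteq> y $ i \<longleftrightarrow> i = q" using 2 i x by auto
      then show "y $ i = (x + unit_vec m q) $ i"
        using i \<open>q < m\<close> x by (cases "x $ i"; cases "y $ i") auto
    qed (use x y in auto)
    ultimately show ?thesis by blast
  qed
qed

lemma hamming_dist_self [simp]: "hamming_dist x x = 0"
  by (simp add: hamming_dist_def)

lemma hamming_dist_triangle:
  assumes "x \<in> carrier_vec m" "y \<in> carrier_vec m"
  shows "hamming_dist x z \<le> hamming_dist x y + hamming_dist y z"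
proof -
  have "hamming_dist x z \<le> card ({i. i < m \<and> x $ i \<noteq> y $ i} \<union> {i. i < m \<and> y $ i \<noteq> z $ i})"
    unfolding hamming_dist_def using assms by (intro card_mono) auto
  also have "\<dots> \<le> hamming_dist x y + hamming_dist y z"
    using assms card_Un_le[of "{i. i < m \<and> x $ i \<noteq> y $ i}"] by (simp add: hamming_dist_def)
  finally show ?thesis .
qed

lemma hamming_dist_commute:
  "x \<in> carrier_vec m \<Longrightarrow> y \<in> carrier_vec m \<Longrightarrow> hamming_dist x y = hamming_dist y x"
  unfolding hamming_dist_def by (intro arg_cong[where f = card]) auto

lemma hamming_dist_flip:
  assumes "x \<in> carrier_vec m" "q < m"
  shows "hamming_dist x (x + unit_vec m q) = 1"
proof -
  have "{i. i < dim_vec x \<and> x $ i \<noteq> (x + unit_vec m q) $ i} = {q}"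
    using assms by (auto simp: split: if_splits)
  then show ?thesis by (simp add: hamming_dist_def)
qed

text \<open>Flipping one differing coordinate of \<open>x\<close> moves it one step towards
  \<open>z\<close>. This turns closeness of two codewords into an overlap of their balls of radius
  1.\<close>

lemma hamming_dist_midpoint:
  assumes x: "x \<in> carrier_vec m" and z: "z \<in> carrier_vec m" and "hamming_dist x z \<le> 2"
  shows "\<exists>y\<in>carrier_vec m. hamming_dist x y \<le> 1 \<and> hamming_dist z y \<le> 1"
proof (cases "x = z")
  case True
  then show ?thesis using x by force
next
  case False
  then obtain p where p: "p < m" "x $ p \<noteq> z $ p" using x z by (metis eq_vecI carrier_vecD)
  let ?y = "x + unit_vec m p"
  have y: "?y \<in> carrier_vec m" using x by simp
  have "{i. i < m \<and> ?y $ i \<noteq> z $ i} = {i. i < m \<and> x $ i \<noteq> z $ i} - {p}"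
    using p x by (cases "x $ p"; cases "z $ p") (auto split: if_splits)
  then have "hamming_dist ?y z = hamming_dist x z - 1"
    using p x y by (simp add: hamming_dist_def)
  then have "hamming_dist z ?y \<le> 1" using assms(3) hamming_dist_commute[OF y z] by simp
  then show ?thesis using hamming_dist_flip[OF x p(1)] y by force
qed

text \<open>Unique covering by balls of radius 1 already forces minimum distance exactly 3.
  Codewords at distance at most 2 would both cover a midpoint, and a pair at distance 3 is found
  near any word that lies at distance 2 from a codeword.\<close>

lemma perfect_code_3I:
  assumes m: "m \<ge> 2" and C: "C \<subseteq> carrier_vec m"
    and ex1: "\<And>y. y \<in> carrier_vec m \<Longrightarrow> \<exists>!x. x \<in> C \<and> hamming_dist x y \<le> 1"
  shows "perfect_code m 3 C"
proof -
  let ?S = "{hamming_dist x y |x y. x \<in> C \<and> y \<in> C \<and> x \<noteq> y}"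
  have ge3: "hamming_dist x y \<ge> 3" if xy: "x \<in> C" "y \<in> C" "x \<noteq> y" for x y
  proof (rule ccontr)
    assume "\<not> ?thesis"
    then have "hamming_dist x y \<le> 2" by simp
    then obtain w where "w \<in> carrier_vec m" "hamming_dist x w \<le> 1" "hamming_dist y w \<le> 1"
      using hamming_dist_midpoint xy C by blast
    then show False using ex1 xy by blast
  qed
  obtain x where x: "x \<in> C" using ex1[of "0\<^sub>v m"] by auto
  \<comment> \<open>At distance 2 from \<open>x\<close>, \<open>y\<close> must be covered by a
    different codeword \<open>z\<close>, which is then at distance at most 3 from
    \<open>x\<close>.\<close>
  define y where "y = x + unit_vec m 0 + unit_vec m 1"
  have xc: "x \<in> carrier_vec m" and yc: "y \<in> carrier_vec m" using x C by (auto simp: y_def)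
  have "{i. i < dim_vec x \<and> x $ i \<noteq> y $ i} = {0, 1}"
    using xc m by (auto simp: y_def split: if_splits)
  then have d2: "hamming_dist x y = 2" by (simp add: hamming_dist_def)
  obtain z where z: "z \<in> C" "hamming_dist z y \<le> 1" using ex1[OF yc] by auto
  then have zc: "z \<in> carrier_vec m" and "x \<noteq> z" using C d2 by auto
  have "hamming_dist x z \<le> 3"
    using hamming_dist_triangle[OF xc yc, of z] z(2) d2 hamming_dist_commute[OF yc zc] by simp
  then have "hamming_dist x z = 3" using ge3[OF x z(1) \<open>x \<noteq> z\<close>] by simp
  then have "3 \<in> ?S" using x z(1) \<open>x \<noteq> z\<close> by force
  then have "min_distance C = 3"
    unfolding min_distance_def using ge3 by (intro cInf_eq_minimum) auto
  then show ?thesis using C ex1 by (simp add: perfect_code_def)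
qed

section \<open>Extension by a parity check\<close>

lemma append_parity_carrier [simp]:
  "x \<in> carrier_vec m \<Longrightarrow> append_parity x \<in> carrier_vec (Suc m)"
  by (intro carrier_vecI) (simp add: append_parity_def)

lemma append_parity_index:
  assumes "x \<in> carrier_vec m" "i \<le> m"
  shows "append_parity x $ i = (if i < m then x $ i else \<Sum>j<m. x $ j)"
  using assms by (auto simp: append_parity_def index_append_vec)

lemma sum_append_parity: "x \<in> carrier_vec m \<Longrightarrow> (\<Sum>i<Suc m. append_parity x $ i) = 0"
  by (simp add: append_parity_index)

lemma append_parity_eqI:
  assumes "y \<in> carrier_vec (Suc m)" "(\<Sum>i<Suc m. y $ i) = 0"
  shows "append_parity (vec m (($) y)) = y"
  using assms by (intro eq_vecI) (auto simp: append_parity_index less_Suc_eq append_parity_def)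

lemma append_parity_flip:
  assumes x: "x \<in> carrier_vec m" and q: "q < m"
  shows "append_parity (x + unit_vec m q)
    = append_parity x + unit_vec (Suc m) q + unit_vec (Suc m) m"
proof (rule eq_vecI)
  have xq: "x + unit_vec m q \<in> carrier_vec m" using x by simp
  fix i assume "i < dim_vec (append_parity x + unit_vec (Suc m) q + unit_vec (Suc m) m)"
  then have i: "i \<le> m" by simp
  have "(\<Sum>j<m. (x + unit_vec m q) $ j) = (\<Sum>j<m. x $ j) + (\<Sum>j<m. if j = q then 1 else 0)"
    unfolding sum.distrib[symmetric] using x q by (intro sum.cong) auto
  then show "append_parity (x + unit_vec m q) $ i
    = (append_parity x + unit_vec (Suc m) q + unit_vec (Suc m) m) $ i"
    using i x q append_parity_index[OF xq i] append_parity_index[OF x i] by auto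
qed (use x in \<open>auto simp: append_parity_def\<close>)

text \<open>Perfection of the punctured code is expressed through double flips in the extended one:
  an error at \<open>q < m\<close> also flips the check bit \<open>m\<close>, and
  \<open>q = m\<close> stands for no error, the two flips cancelling. Thus \<open>cov\<close> yields
  a codeword in each ball, and \<open>sep\<close> makes it unique.\<close>

lemma extended_perfect_codeI:
  assumes m: "m \<ge> 2" and C: "C \<subseteq> carrier_vec (Suc m)"
    and even: "\<And>x. x \<in> C \<Longrightarrow> (\<Sum>i<Suc m. x $ i) = 0"
    and sep: "\<And>x p q. x \<in> C \<Longrightarrow> p \<le> m \<Longrightarrow> q \<le> m \<Longrightarrow> p \<noteq> q \<Longrightarrow>
      x + unit_vec (Suc m) p + unit_vec (Suc m) q \<notin> C"
    and cov: "\<And>y. y \<in> carrier_vec (Suc m) \<Longrightarrow> (\<Sum>i<Suc m. y $ i) = 0 \<Longrightarrow>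
      \<exists>q\<le>m. y + unit_vec (Suc m) q + unit_vec (Suc m) m \<in> C"
  shows "extended_perfect_code (Suc m) C"
proof -
  define C' where "C' = {x \<in> carrier_vec m. append_parity x \<in> C}"
  have uniq: "x = z" if xz: "x \<in> C'" "z \<in> C'" and y: "y \<in> carrier_vec m"
    and d: "hamming_dist x y \<le> 1" "hamming_dist z y \<le> 1" for x y z
  proof (rule ccontr)
    assume "x \<noteq> z"
    have xc: "x \<in> carrier_vec m" and zc: "z \<in> carrier_vec m" using xz by (auto simp: C'_def)
    \<comment> \<open>Codewords one flip apart extend to words differing at \<open>q\<close> and
      \<open>m\<close>, against \<open>sep\<close>.\<close>
    have single: False if "a \<in> C'" "b \<in> C'" "b = a + unit_vec m q" "q < m" for a b q
      using that sep[of "append_parity a" q m] by (auto simp: C'_def append_parity_flip)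
    consider "y = x" | p where "p < m" "y = x + unit_vec m p"
      using hamming_dist_le_1D[OF xc y d(1)] by blast
    then show False
    proof cases
      case 1
      then show False using hamming_dist_le_1D[OF zc y d(2)] \<open>x \<noteq> z\<close> single xz by blast
    next
      case (2 p)
      consider "y = z" | q where "q < m" "y = z + unit_vec m q"
        using hamming_dist_le_1D[OF zc y d(2)] by blast
      then show False
      proof cases
        case 1
        then show False using 2 single xz by blast
      next
        case (2 q)
        let ?u = "unit_vec (Suc m)"
        have eq: "x + unit_vec m p = z + unit_vec m q" using 2 \<open>y = x + unit_vec m p\<close> by simp
        have "p \<noteq> q"
          using eq \<open>x \<noteq> z\<close> unit_vec_add_cancel[OF xc, of p] unit_vec_add_cancel[OF zc, of q] by metis
        have "z = x + unit_vec m p + unit_vec m q"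
          using eq unit_vec_add_cancel[OF zc, of q] by metis
        also have "append_parity \<dots> = append_parity x + ?u p + ?u m + ?u q + ?u m"
          using xc \<open>p < m\<close> \<open>q < m\<close> by (simp add: append_parity_flip del: assoc_add_vec)
        \<comment> \<open>The two flips of the check bit cancel, so again exactly two flips
          remain.\<close>
        also have "\<dots> = append_parity x + ?u p + ?u q"
          using append_parity_carrier[OF xc] by (intro eq_vecI) auto
        finally have "append_parity z = append_parity x + ?u p + ?u q" .
        then show False using sep[of "append_parity x" p q] xz \<open>p < m\<close> \<open>q < m\<close> \<open>p \<noteq> q\<close>
          by (auto simp: C'_def)
      qed
    qed
  qed
  have "\<exists>!x. x \<in> C' \<and> hamming_dist x y \<le> 1" if y: "y \<in> carrier_vec m" for y
  proof -
    obtain q where q: "q \<le> m" "append_parity y + unit_vec (Suc m) q + unit_vec (Suc m) m \<in> C"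
      using cov[of "append_parity y"] sum_append_parity y by auto
    have "\<exists>x. x \<in> C' \<and> hamming_dist x y \<le> 1"
    proof (cases "q = m")
      case True
      then show ?thesis using q y by (intro exI[of _ y]) (auto simp: C'_def)
    next
      case False
      then have "q < m" using q by simp
      then show ?thesis using q y hamming_dist_flip[OF y, of q]
          hamming_dist_commute[OF y, of "y + unit_vec m q"]
        by (intro exI[of _ "y + unit_vec m q"]) (auto simp: C'_def append_parity_flip)
    qed
    then show ?thesis using uniq[OF _ _ y] by blast
  qed
  then have "perfect_code m 3 C'" by (intro perfect_code_3I m) (auto simp: C'_def)
  moreover have "C = append_parity ` C'"
  proof (rule Set.set_eqI)
    fix x
    show "x \<in> C \<longleftrightarrow> x \<in> append_parity ` C'"
    proof
      assume x: "x \<in> C"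
      then have "append_parity (vec m (($) x)) = x" using C even append_parity_eqI by blast
      then show "x \<in> append_parity ` C'" using x
        by (intro image_eqI[of _ _ "vec m (($) x)"]) (auto simp: C'_def)
    qed (auto simp: C'_def)
  qed
  ultimately show ?thesis unfolding extended_perfect_code_def by auto
qed

section \<open>Folds, upper parities and swaps\<close>

text \<open>The value 0 from \<open>M\<close> on makes equality of folds plain equality of
  functions.\<close>

definition fold_word :: "nat \<Rightarrow> bit vec \<Rightarrow> nat \<Rightarrow> bit" where
  "fold_word M x i = (if i < M then x $ i + x $ (M + i) else 0)"

definition upper_parity :: "nat \<Rightarrow> bit vec \<Rightarrow> bit" where
  "upper_parity M x = (\<Sum>i<M. x $ (M + i))"

text \<open>The parity check matrix has an all-one row, and below it column \<open>i\<close> is the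
  binary expansion of \<open>i\<close>.\<close>

definition ext_hamming :: "nat \<Rightarrow> (nat \<Rightarrow> bit) \<Rightarrow> bool" where
  "ext_hamming k c \<longleftrightarrow> (\<Sum>i<2 ^ k. c i) = 0 \<and> (\<forall>t<k. (\<Sum>i<2 ^ k. of_bool (bit i t) * c i) = 0)"

definition quad :: "(nat \<times> nat) set \<Rightarrow> (nat \<Rightarrow> bit) \<Rightarrow> bit" where
  "quad E c = (\<Sum>(i, j)\<in>E. c i * c j)"

text \<open>The vector representing the linear form \<open>d \<mapsto> quad E (c + d) + quad E c + quad E d\<close>.\<close>

definition polar :: "(nat \<times> nat) set \<Rightarrow> (nat \<Rightarrow> bit) \<Rightarrow> nat \<Rightarrow> bit" where
  "polar E c p = (\<Sum>(i, j)\<in>E. of_bool (p = j) * c i + of_bool (p = i) * c j)"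

text \<open>
  These are the words \<open>(u + c | u)\<close> with \<open>c\<close> in the extended Hamming code of length \<open>2 ^ k\<close> and
  \<open>u\<close> of weight congruent to \<open>quad E c\<close> modulo 2; \<open>fold_word\<close> recovers \<open>c\<close>.
\<close>

definition vasilev_code :: "nat \<Rightarrow> (nat \<times> nat) set \<Rightarrow> bit vec set" where
  "vasilev_code k E = {x \<in> carrier_vec (2 * 2 ^ k). ext_hamming k (fold_word (2 ^ k) x) \<and>
     upper_parity (2 ^ k) x = quad E (fold_word (2 ^ k) x)}"

definition swap_halves :: "nat \<Rightarrow> (nat \<Rightarrow> bit) \<Rightarrow> nat \<Rightarrow> nat" where
  "swap_halves M s i = (if i < M \<and> s i = 1 then M + i
     else if M \<le> i \<and> i < 2 * M \<and> s (i - M) = 1 then i - M else i)"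

lemma fold_word_add:
  assumes "x \<in> carrier_vec (2 * M)" "y \<in> carrier_vec (2 * M)"
  shows "fold_word M (x + y) = (\<lambda>i. fold_word M x i + fold_word M y i)"
  using assms by (auto simp: fold_word_def fun_eq_iff ac_simps)

lemma upper_parity_add:
  assumes "x \<in> carrier_vec (2 * M)" "y \<in> carrier_vec (2 * M)"
  shows "upper_parity M (x + y) = upper_parity M x + upper_parity M y"
  using assms by (simp add: upper_parity_def sum.distrib)

lemma fold_word_unit:
  assumes "q < 2 * M"
  shows "fold_word M (unit_vec (2 * M) q) = (\<lambda>i. of_bool (i = q mod M))"
proof
  fix i
  consider "q < M" | r where "q = M + r" "r < M" using assms
    by (metis add_less_cancel_left le_iff_add mult_2 not_le)
  then show "fold_word M (unit_vec (2 * M) q) i = of_bool (i = q mod M)"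
    by cases (auto simp: fold_word_def)
qed

lemma upper_parity_unit:
  assumes "q < 2 * M"
  shows "upper_parity M (unit_vec (2 * M) q) = of_bool (M \<le> q)"
proof -
  have "upper_parity M (unit_vec (2 * M) q) = (\<Sum>i<M. if i = q - M then of_bool (M \<le> q) else 0)"
    using assms unfolding upper_parity_def by (intro sum.cong) auto
  then show ?thesis using assms by auto
qed

lemma sum_fold_word:
  assumes "x \<in> carrier_vec (2 * M)"
  shows "(\<Sum>i<M. fold_word M x i) = (\<Sum>i<2 * M. x $ i)"
proof -
  have "(\<Sum>i<2 * M. x $ i) = (\<Sum>i<M. x $ i) + (\<Sum>i<M. x $ (M + i))"
    unfolding mult_2
  proof -
    show "(\<Sum>i<M + n. x $ i) = (\<Sum>i<M. x $ i) + (\<Sum>i<n. x $ (M + i))" for n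
      by (induction n) (simp_all add: add.assoc)
  qed
  then show ?thesis by (simp add: fold_word_def sum.distrib)
qed

section \<open>The extended Hamming code and perfection of the switched codes\<close>

lemma ext_hamming_add:
  "ext_hamming k c \<Longrightarrow> ext_hamming k d \<Longrightarrow> ext_hamming k (\<lambda>i. c i + d i)"
  by (simp add: ext_hamming_def sum.distrib distrib_left)

lemma bit_eq_below:
  assumes "a < 2 ^ k" "b < 2 ^ k" "\<And>t. t < k \<Longrightarrow> bit a t = bit b t"
  shows "a = (b :: nat)"
proof -
  have "take_bit k a = take_bit k b" using assms(3) by (auto simp: bit_eq_iff bit_take_bit_iff)
  then show ?thesis using assms(1,2) by (simp add: take_bit_nat_eq_self)
qed

lemma exists_nat_bits: "\<exists>r::nat. r < 2 ^ k \<and> (\<forall>t<k. bit r t = P t)"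
proof (intro exI conjI)
  let ?r = "horner_sum of_bool 2 (map P [0..<k]) :: nat"
  show "?r < 2 ^ k" using horner_sum_of_bool_2_less[of "map P [0..<k]"] by simp
  show "\<forall>t<k. bit ?r t = P t" by (simp add: bit_horner_sum_bit_iff)
qed

lemma sum_of_bool_eq:
  fixes f :: "nat \<Rightarrow> bit"
  assumes "a < M"
  shows "(\<Sum>i<M. f i * of_bool (i = a)) = f a"
proof -
  have "(\<Sum>i<M. f i * of_bool (i = a)) = (\<Sum>i<M. if i = a then f i else 0)"
    by (intro sum.cong) auto
  then show ?thesis using assms by simp
qed

text \<open>Distinct positions have distinct binary expansions, so no codeword has weight 2.\<close>

lemma ext_hamming_two:
  assumes "a < 2 ^ k" "b < 2 ^ k" "ext_hamming k (\<lambda>i. of_bool (i = a) + of_bool (i = b))"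
  shows "a = b"
proof (rule bit_eq_below[OF assms(1,2)])
  fix t assume "t < k"
  then have "(\<Sum>i<2 ^ k. of_bool (bit i t) * (of_bool (i = a) + of_bool (i = b) :: bit)) = 0"
    using assms(3) by (simp add: ext_hamming_def)
  then have "of_bool (bit a t) + of_bool (bit b t) = (0::bit)"
    using assms(1,2) by (simp only: distrib_left sum.distrib sum_of_bool_eq)
  then show "bit a t = bit b t" by (cases "bit a t"; cases "bit b t") auto
qed

text \<open>Syndrome decoding: an even word becomes a codeword by flipping a prescribed position
  \<open>b\<close> and the position whose binary expansion is the remaining syndrome.\<close>

lemma ext_hamming_correct:
  assumes "(\<Sum>i<2 ^ k. c i) = 0" "b < 2 ^ k"
  shows "\<exists>r<2 ^ k. ext_hamming k (\<lambda>i. c i + of_bool (i = r) + of_bool (i = b))"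
proof -
  \<comment> \<open>\<open>P t\<close> is bit \<open>t\<close> of the syndrome of \<open>c\<close>
    after the flip at \<open>b\<close>.\<close>
  define P where "P t \<longleftrightarrow> (\<Sum>i<2 ^ k. of_bool (bit i t) * c i) + of_bool (bit b t) = 1" for t
  obtain r :: nat where r: "r < 2 ^ k" "\<And>t. t < k \<Longrightarrow> bit r t = P t"
    using exists_nat_bits by blast
  have "(\<Sum>i<2 ^ k. c i + of_bool (i = r) + of_bool (i = b)) = 0"
    using assms r(1) sum_of_bool_eq[of _ "2 ^ k" "\<lambda>_. 1"] by (simp add: sum.distrib)
  moreover have "(\<Sum>i<2 ^ k. of_bool (bit i t) * (c i + of_bool (i = r) + of_bool (i = b))) = 0"
    if "t < k" for t
  proof -
    have "(\<Sum>i<2 ^ k. of_bool (bit i t) * (c i + of_bool (i = r) + of_bool (i = b)))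
      = (\<Sum>i<2 ^ k. of_bool (bit i t) * c i) + of_bool (bit r t) + of_bool (bit b t)"
      using assms(2) r(1) by (simp only: distrib_left sum.distrib sum_of_bool_eq)
    also have "\<dots> = 0"
      using r(2)[OF that] unfolding P_def
      by (cases "(\<Sum>i<2 ^ k. of_bool (bit i t) * c i)"; cases "bit b t"; cases "bit r t") auto
    finally show ?thesis .
  qed
  ultimately show ?thesis using r(1) by (auto simp: ext_hamming_def)
qed

text \<open>A flip at \<open>p\<close> flips the fold at \<open>p mod M\<close>, and changes the
  upper parity iff \<open>p\<close> is in the upper half. So the Hamming condition on the fold
  determines an error position modulo \<open>M\<close>, and the parity condition determines the
  half.\<close>

lemma vasilev_code_extended_perfect:
  assumes k: "k \<ge> 1"
  shows "extended_perfect_code (2 * 2 ^ k) (vasilev_code k E)"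
proof -
  define M :: nat where "M = 2 ^ k"
  define m where "m = 2 * M - 1"
  have M2: "M \<ge> 2" using power_increasing[OF k, of "2::nat"] by (simp add: M_def)
  then have m: "m \<ge> 2" and Sm: "Suc m = 2 * M" by (auto simp: m_def)
  have mem: "x \<in> vasilev_code k E \<longleftrightarrow> x \<in> carrier_vec (2 * M) \<and> ext_hamming k (fold_word M x) \<and>
     upper_parity M x = quad E (fold_word M x)" for x
    by (simp add: vasilev_code_def M_def)
  have flip2: "fold_word M (x + unit_vec (2 * M) p + unit_vec (2 * M) q)
      = (\<lambda>i. fold_word M x i + of_bool (i = p mod M) + of_bool (i = q mod M))"
    "upper_parity M (x + unit_vec (2 * M) p + unit_vec (2 * M) q)
      = upper_parity M x + of_bool (M \<le> p) + of_bool (M \<le> q)"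
    if "x \<in> carrier_vec (2 * M)" "p < 2 * M" "q < 2 * M" for x p q
    using that by (simp_all add: fold_word_add fold_word_unit upper_parity_add upper_parity_unit
        del: assoc_add_vec)
  have "extended_perfect_code (Suc m) (vasilev_code k E)"
  proof (rule extended_perfect_codeI[OF m])
    show "vasilev_code k E \<subseteq> carrier_vec (Suc m)" by (auto simp: mem Sm)
  next
    fix x assume "x \<in> vasilev_code k E"
    then show "(\<Sum>i<Suc m. x $ i) = 0"
      unfolding Sm by (simp add: mem ext_hamming_def flip: M_def sum_fold_word)
  next
    fix x p q assume x: "x \<in> vasilev_code k E" and pq: "p \<le> m" "q \<le> m" "p \<noteq> q"
    have lt: "p < 2 * M" "q < 2 * M" using pq Sm by auto
    have xc: "x \<in> carrier_vec (2 * M)" using x by (simp add: mem)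
    let ?z = "x + unit_vec (2 * M) p + unit_vec (2 * M) q"
    have "?z \<notin> vasilev_code k E"
    proof
      assume z: "?z \<in> vasilev_code k E"
      \<comment> \<open>By linearity the difference of the two folds is a Hamming codeword, here
        with at most two ones.\<close>
      have "ext_hamming k (\<lambda>i. fold_word M x i + fold_word M ?z i)"
        using x z by (intro ext_hamming_add) (auto simp: mem)
      then have "ext_hamming k (\<lambda>i. of_bool (i = p mod M) + of_bool (i = q mod M))"
        by (simp add: flip2[OF xc lt] add.assoc)
      then have pq_mod: "p mod M = q mod M"
        using ext_hamming_two[of "p mod M" k "q mod M"] by (simp add: M_def)
      then have "fold_word M ?z = fold_word M x" by (simp add: flip2[OF xc lt] add.assoc)
      then have "upper_parity M ?z = upper_parity M x" using x z by (simp add: mem)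
      then have "M \<le> p \<longleftrightarrow> M \<le> q"
        unfolding flip2[OF xc lt] by (cases "M \<le> p"; cases "M \<le> q") (auto simp: add.assoc)
      then have "p = q" using pq_mod lt
        by (cases "M \<le> p") (auto simp: mod_if split: if_splits)
      then show False using pq by simp
    qed
    then show "x + unit_vec (Suc m) p + unit_vec (Suc m) q \<notin> vasilev_code k E" unfolding Sm .
  next
    fix y :: "bit vec" assume y: "y \<in> carrier_vec (Suc m)" and even: "(\<Sum>i<Suc m. y $ i) = 0"
    have yc: "y \<in> carrier_vec (2 * M)" using y Sm by simp
    \<comment> \<open>The check coordinate is the last one, so it lies in the upper half and folds
      to \<open>M - 1\<close>.\<close>
    have mM: "m mod M = M - 1" "M \<le> m" using M2 by (auto simp: m_def mod_if)
    have "(\<Sum>i<2 ^ k. fold_word M y i) = 0"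
      using even by (simp only: Sm sum_fold_word[OF yc] flip: M_def)
    then obtain r where r: "r < M" "ext_hamming k (\<lambda>i. fold_word M y i + of_bool (i = r) + of_bool (i = M - 1))"
      using ext_hamming_correct[where k = k and c = "fold_word M y" and b = "M - 1"] M2 by (auto simp: M_def)
    define c where "c = (\<lambda>i. fold_word M y i + of_bool (i = r) + of_bool (i = M - 1))"
    \<comment> \<open>Both \<open>r\<close> and \<open>M + r\<close> repair the fold; the choice
      between them repairs the upper parity. The summand 1 is the effect of the flip at
      \<open>m\<close>.\<close>
    define q where "q = (if upper_parity M y + 1 = quad E c then r else M + r)"
    have q: "q < 2 * M" "q mod M = r" using r(1) by (auto simp: q_def)
    have "upper_parity M y + of_bool (M \<le> q) + 1 = quad E c"
      using r(1) unfolding q_def by (cases "upper_parity M y"; cases "quad E c") auto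
    moreover have "m < 2 * M" using Sm by simp
    moreover have "fold_word M (y + unit_vec (2 * M) q + unit_vec (2 * M) m) = c"
      unfolding c_def flip2(1)[OF yc q(1) \<open>m < 2 * M\<close>] q(2) mM(1) ..
    moreover have "ext_hamming k c" unfolding c_def by (rule r(2))
    ultimately have "y + unit_vec (2 * M) q + unit_vec (2 * M) m \<in> vasilev_code k E"
      using yc mM(2) by (simp add: mem flip2(2)[OF yc q(1)] del: assoc_add_vec)
    then show "\<exists>q\<le>m. y + unit_vec (Suc m) q + unit_vec (Suc m) m \<in> vasilev_code k E"
      using q(1) Sm by (intro exI[of _ q]) auto
  qed
  then show ?thesis by (simp add: Sm M_def)
qed

section \<open>Quadratic forms and the propelinear structure\<close>

lemma quad_add:
  "quad E (\<lambda>i. c i + d i) = quad E c + quad E d + (\<Sum>(i, j)\<in>E. c i * d j + c j * d i)"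
  unfolding quad_def sum.distrib[symmetric] by (intro sum.cong) (auto simp: algebra_simps)

lemma polar_add: "polar E (\<lambda>i. c i + d i) = (\<lambda>p. polar E c p + polar E d p)"
  unfolding polar_def sum.distrib[symmetric] fun_eq_iff
  by (intro allI sum.cong) (auto simp: algebra_simps)

lemma sum_polar:
  assumes "E \<subseteq> {..<M} \<times> {..<M}"
  shows "(\<Sum>p<M. polar E c p * d p) = (\<Sum>(i, j)\<in>E. c i * d j + c j * d i)"
proof -
  have "(\<Sum>p<M. polar E c p * d p)
    = (\<Sum>(i, j)\<in>E. \<Sum>p<M. (c i * d p) * of_bool (p = j) + (c j * d p) * of_bool (p = i))"
    unfolding polar_def sum_distrib_right
    by (subst sum.swap) (intro sum.cong, auto simp: algebra_simps)
  also have "\<dots> = (\<Sum>(i, j)\<in>E. c i * d j + c j * d i)"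
    using assms by (intro sum.cong) (auto simp: sum.distrib sum_of_bool_eq)
  finally show ?thesis .
qed

text \<open>On each pair \<open>i\<close>, \<open>M + i\<close> the swap has order 2, so selectors
  add over F_2. With equal selectors this gives the involution property.\<close>

lemma swap_halves_comp: "swap_halves M s \<circ> swap_halves M s' = swap_halves M (\<lambda>i. s i + s' i)"
proof
  fix i
  consider "i < M" | r where "i = M + r" "r < M" | "i \<ge> 2 * M"
    by (metis add_less_cancel_left le_iff_add mult_2 not_le)
  then show "(swap_halves M s \<circ> swap_halves M s') i = swap_halves M (\<lambda>i. s i + s' i) i"
    by cases (auto simp: swap_halves_def)
qed

lemma swap_halves_involution: "swap_halves M s (swap_halves M s i) = i"
  using fun_cong[OF swap_halves_comp, of M s s i] by (simp add: swap_halves_def)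

lemma inv_swap_halves: "Hilbert_Choice.inv (swap_halves M s) = swap_halves M s"
  by (rule inv_equality) (simp_all add: swap_halves_involution)

lemma swap_halves_less: "i < 2 * M \<Longrightarrow> swap_halves M s i < 2 * M"
  by (auto simp: swap_halves_def)

lemma swap_halves_permutes: "swap_halves M s permutes {..<2 * M}"
  unfolding permutes_def
proof (intro conjI allI impI)
  fix i assume "i \<notin> {..<2 * M}"
  then show "swap_halves M s i = i" by (auto simp: swap_halves_def)
next
  fix j show "\<exists>!i. swap_halves M s i = j" by (metis swap_halves_involution)
qed

lemma permute_swap_halves_involution:
  assumes "x \<in> carrier_vec (2 * M)"
  shows "permute_coords (swap_halves M s) (permute_coords (swap_halves M s) x) = x"
  using assms by (intro eq_vecI)
    (auto simp: permute_coords_def inv_swap_halves swap_halves_less swap_halves_involution)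

lemma permute_coords_carrier [simp]:
  "x \<in> carrier_vec N \<Longrightarrow> permute_coords \<sigma> x \<in> carrier_vec N"
  by (simp add: permute_coords_def)

lemma fold_word_swap:
  assumes "x \<in> carrier_vec (2 * M)"
  shows "fold_word M (permute_coords (swap_halves M s) x) = fold_word M x"
  using assms
  by (auto simp: fold_word_def permute_coords_def inv_swap_halves swap_halves_def fun_eq_iff add.commute)

text \<open>A swap at \<open>i\<close> replaces the upper bit by the lower one, and these differ by
  \<open>fold_word M x i\<close>.\<close>

lemma upper_parity_swap:
  assumes "x \<in> carrier_vec (2 * M)"
  shows "upper_parity M (permute_coords (swap_halves M s) x)
    = upper_parity M x + (\<Sum>i<M. s i * fold_word M x i)"
  unfolding upper_parity_def sum.distrib[symmetric] using assms
  by (intro sum.cong)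
    (auto simp: fold_word_def permute_coords_def inv_swap_halves swap_halves_def ac_simps)

text \<open>The permutation \<open>\<pi> x\<close> depends only on the fold of \<open>x\<close>, and
  swaps preserve folds. Hence folds add under the operation, and the composition rule follows from
  linearity of \<open>polar\<close>.\<close>

lemma vasilev_code_propelinear:
  assumes E: "E \<subseteq> {..<2 ^ k} \<times> {..<2 ^ k}"
  shows "propelinear (2 * 2 ^ k) (vasilev_code k E)"
proof -
  define M :: nat where "M = 2 ^ k"
  define \<pi> where "\<pi> x = swap_halves M (polar E (fold_word M x))" for x
  have mem: "x \<in> vasilev_code k E \<longleftrightarrow> x \<in> carrier_vec (2 * M) \<and> ext_hamming k (fold_word M x) \<and>
     upper_parity M x = quad E (fold_word M x)" for x
    by (simp add: vasilev_code_def M_def)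
  have closed: "x + permute_coords (\<pi> x) y \<in> vasilev_code k E"
    and fold: "fold_word M (x + permute_coords (\<pi> x) y) = (\<lambda>i. fold_word M x i + fold_word M y i)"
    if x: "x \<in> vasilev_code k E" and y: "y \<in> vasilev_code k E" for x y
  proof -
    have c: "x \<in> carrier_vec (2 * M)" "y \<in> carrier_vec (2 * M)" using x y by (auto simp: mem)
    show fold: "fold_word M (x + permute_coords (\<pi> x) y) = (\<lambda>i. fold_word M x i + fold_word M y i)"
      using c by (simp add: fold_word_add fold_word_swap \<pi>_def)
    show "x + permute_coords (\<pi> x) y \<in> vasilev_code k E"
      unfolding mem fold using c x y E
      by (simp add: upper_parity_add upper_parity_swap \<pi>_def quad_add sum_polar ext_hamming_add mem
          M_def add.assoc)
  qed
  have "(\<lambda>y. x + permute_coords (\<pi> x) y) ` vasilev_code k E = vasilev_code k E"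
    if x: "x \<in> vasilev_code k E" for x
  proof
    show "(\<lambda>y. x + permute_coords (\<pi> x) y) ` vasilev_code k E \<subseteq> vasilev_code k E"
      using closed[OF x] by auto
    show "vasilev_code k E \<subseteq> (\<lambda>y. x + permute_coords (\<pi> x) y) ` vasilev_code k E"
    proof
      fix w assume w: "w \<in> vasilev_code k E"
      define s where "s = polar E (fold_word M x)"
      \<comment> \<open>This solves \<open>x + permute_coords (\<pi> x) y = w\<close>, as swapping
        and adding \<open>x\<close> are both self-inverse.\<close>
      define y where "y = permute_coords (swap_halves M s) (x + w)"
      have c: "x \<in> carrier_vec (2 * M)" "w \<in> carrier_vec (2 * M)" using x w by (auto simp: mem)
      have yf: "fold_word M y = (\<lambda>i. fold_word M x i + fold_word M w i)"
        using c by (simp add: y_def fold_word_add fold_word_swap)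
      have "(\<Sum>i<M. s i * fold_word M x i)
        = (\<Sum>(i, j)\<in>E. fold_word M x i * fold_word M x j + fold_word M x j * fold_word M x i)"
        unfolding s_def using E by (intro sum_polar) (simp add: M_def)
      \<comment> \<open>The polar form is alternating: each monomial contributes the same product
        twice.\<close>
      also have "\<dots> = 0" by (simp add: mult.commute)
      finally have "(\<Sum>i<M. s i * fold_word M x i) = 0" .
      then have "upper_parity M y = quad E (fold_word M y)"
        unfolding yf using c x w E
        by (simp add: y_def upper_parity_swap upper_parity_add fold_word_add quad_add mem
            distrib_left sum.distrib) (simp add: s_def sum_polar M_def)
      then have "y \<in> vasilev_code k E"
        using c x w ext_hamming_add by (simp add: mem yf) (simp add: y_def)
      moreover have "x + permute_coords (\<pi> x) y = x + (x + w)"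
        using c by (simp add: y_def \<pi>_def permute_swap_halves_involution flip: s_def)
      moreover have "x + (x + w) = w" using c by (intro eq_vecI) auto
      ultimately show "w \<in> (\<lambda>y. x + permute_coords (\<pi> x) y) ` vasilev_code k E"
        by (metis image_eqI)
    qed
  qed
  moreover have "\<pi> (x + permute_coords (\<pi> x) y) = \<pi> x \<circ> \<pi> y"
    if "x \<in> vasilev_code k E" "y \<in> vasilev_code k E" for x y
    using fold[OF that] by (simp add: \<pi>_def swap_halves_comp polar_add)
  ultimately show ?thesis
    unfolding propelinear_def using swap_halves_permutes
    by (intro conjI exI[of _ \<pi>]) (auto simp: mem \<pi>_def M_def)
qed

section \<open>Equivalence classes and the selection of representatives\<close>

lemma finite_card_carrier_vec_bit:
  "finite (carrier_vec N :: bit vec set)" "card (carrier_vec N :: bit vec set) \<le> 2 ^ N"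
proof -
  let ?F = "{..<N} \<rightarrow>\<^sub>E (UNIV :: bit set)"
  have U: "(UNIV :: bit set) = {0, 1}" by (auto intro: bit.exhaust)
  have fin: "finite ?F" and card: "card ?F = 2 ^ N"
    by (auto intro!: finite_PiE simp: card_funcsetE U numeral_2_eq_2)
  have "x \<in> vec N ` ?F" if "x \<in> carrier_vec N" for x :: "bit vec"
    using that by (intro image_eqI[of _ _ "restrict (($) x) {..<N}"] eq_vecI) auto
  then have sub: "(carrier_vec N :: bit vec set) \<subseteq> vec N ` ?F" by blast
  show "finite (carrier_vec N :: bit vec set)" using finite_subset[OF sub] fin by blast
  show "card (carrier_vec N :: bit vec set) \<le> 2 ^ N"
    using surj_card_le[OF fin sub] card by simp
qed

lemma equivalent_codes_sym:
  assumes "equivalent_codes N C D" "C \<subseteq> carrier_vec N"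
  shows "equivalent_codes N D C"
proof -
  obtain \<sigma> a where \<sigma>: "\<sigma> permutes {..<N}" and a: "a \<in> carrier_vec N"
    and D: "D = (\<lambda>x. a + permute_coords \<sigma> x) ` C"
    using assms(1) unfolding equivalent_codes_def by blast
  let ?\<tau> = "Hilbert_Choice.inv \<sigma>"
  have \<tau>: "?\<tau> permutes {..<N}" using \<sigma> by (rule permutes_inv)
  have lt: "\<sigma> i < N" if "i < N" for i using permutes_in_image[OF \<sigma>, of i] that by simp
  have inv: "Hilbert_Choice.inv ?\<tau> = \<sigma>" using \<sigma> permutes_inv_inv by blast
  \<comment> \<open>The inverse isometry applies \<open>?\<tau>\<close> and translates by the image
    of \<open>a\<close>; in characteristic 2 there is no sign.\<close>
  have "permute_coords ?\<tau> a + permute_coords ?\<tau> (a + permute_coords \<sigma> x) = x"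
    if "x \<in> carrier_vec N" for x
    using that a lt by (intro eq_vecI)
      (auto simp: permute_coords_def inv permutes_inverses[OF \<sigma>])
  then have "(\<lambda>y. permute_coords ?\<tau> a + permute_coords ?\<tau> y) ` D = C"
    unfolding D image_image using assms(2) by (simp add: subset_iff)
  moreover have "permute_coords ?\<tau> a \<in> carrier_vec N" using a by (simp add: permute_coords_def)
  ultimately show ?thesis using \<tau> unfolding equivalent_codes_def by blast
qed

lemma equivalent_codes_refl:
  assumes "C \<subseteq> carrier_vec N"
  shows "equivalent_codes N C C"
proof -
  have "0\<^sub>v N + permute_coords id x = x" if "x \<in> carrier_vec N" for x
    using that by (intro eq_vecI) (auto simp: permute_coords_def inv_id)
  then have "(\<lambda>x. 0\<^sub>v N + permute_coords id x) ` C = C" using assms by (simp add: subset_iff)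
  then show ?thesis unfolding equivalent_codes_def
    by (intro exI[of _ id] exI[of _ "0\<^sub>v N"]) (simp add: permutes_id)
qed

lemma card_equivalent_codes:
  "finite {D. equivalent_codes N C D}" "card {D. equivalent_codes N C D} \<le> fact N * 2 ^ N"
proof -
  let ?P = "{\<sigma>. \<sigma> permutes {..<N}} \<times> (carrier_vec N :: bit vec set)"
  have fin: "finite ?P" by (simp add: finite_permutations finite_card_carrier_vec_bit)
  have sub: "{D. equivalent_codes N C D} \<subseteq> (\<lambda>(\<sigma>, a). (\<lambda>x. a + permute_coords \<sigma> x) ` C) ` ?P"
    unfolding equivalent_codes_def by auto
  show "finite {D. equivalent_codes N C D}" using finite_subset[OF sub] fin by blast
  have "card {D. equivalent_codes N C D} \<le> card ?P" by (rule surj_card_le[OF fin sub])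
  also have "\<dots> \<le> fact N * 2 ^ N"
    unfolding card_cartesian_product card_permutations[of "{..<N}" N, OF card_lessThan finite_lessThan]
    by (rule mult_le_mono2[OF finite_card_carrier_vec_bit(2)])
  finally show "card {D. equivalent_codes N C D} \<le> fact N * 2 ^ N" .
qed

text \<open>Greedy choice: keep some \<open>x\<close>, discard the at most \<open>K\<close> elements
  related to it, and continue in the rest \<open>U\<close>. Reflexivity makes \<open>U\<close>
  strictly smaller; symmetry rules out relations from later elements back to
  \<open>x\<close>.\<close>

lemma exists_pairwise_inequivalent:
  fixes R :: "'a \<Rightarrow> 'a \<Rightarrow> bool"
  assumes "finite T" "\<And>x. x \<in> T \<Longrightarrow> R x x" "\<And>x y. x \<in> T \<Longrightarrow> y \<in> T \<Longrightarrow> R x y \<Longrightarrow> R y x"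
    and "\<And>x. x \<in> T \<Longrightarrow> card {y \<in> T. R x y} \<le> K"
  shows "\<exists>S\<subseteq>T. pairwise (\<lambda>x y. \<not> R x y) S \<and> card T \<le> K * card S"
  using assms
proof (induction T rule: finite_psubset_induct)
  case (psubset T)
  show ?case
  proof (cases "T = {}")
    case False
    then obtain x where x: "x \<in> T" by auto
    define U where "U = {y \<in> T. \<not> R x y}"
    have UT: "U \<subset> T" using x psubset.prems(1) by (auto simp: U_def)
    have "card {y \<in> U. R z y} \<le> K" if "z \<in> U" for z
    proof -
      have "{y \<in> U. R z y} \<subseteq> {y \<in> T. R z y}" using UT by blast
      moreover have "finite {y \<in> T. R z y}" using \<open>finite T\<close> by simp
      ultimately have "card {y \<in> U. R z y} \<le> card {y \<in> T. R z y}" by (rule card_mono[rotated])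
      also have "\<dots> \<le> K" using psubset.prems(3) that UT by blast
      finally show ?thesis .
    qed
    then obtain S where S: "S \<subseteq> U" "pairwise (\<lambda>x y. \<not> R x y) S" "card U \<le> K * card S"
      using psubset.IH[OF UT] psubset.prems(1,2) UT by (metis psubsetD)
    have "x \<notin> S" using S(1) psubset.prems(1) x by (auto simp: U_def)
    have fS: "finite S" using S(1) UT \<open>finite T\<close> by (meson finite_subset psubset_imp_subset)
    have "T = U \<union> {y \<in> T. R x y}" by (auto simp: U_def)
    then have "card T \<le> card U + card {y \<in> T. R x y}" using card_Un_le by metis
    also have "\<dots> \<le> K * card (insert x S)"
      using S(3) psubset.prems(3)[OF x] \<open>x \<notin> S\<close> fS by simp
    finally have "card T \<le> K * card (insert x S)" .
    moreover have "pairwise (\<lambda>x y. \<not> R x y) (insert x S)"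
      using S(1,2) psubset.prems(2) x by (auto simp: pairwise_insert U_def)
    ultimately show ?thesis using x S(1) UT by (intro exI[of _ "insert x S"]) auto
  qed auto
qed

section \<open>The growth estimate and the separation of the codes\<close>

text \<open>In logarithms the left side is of order \<open>x * ln x\<close> and the right side is
  quadratic. The power \<open>(4 * x) powr (4 * x)\<close> stands in for the factorial, and
  \<open>(x / 2)\<^sup>2\<close> counts the available monomials.\<close>

lemma growth_comparison:
  "eventually (\<lambda>x::real. 1 / (8 * x\<^sup>2 * sqrt 3) * exp (pi * sqrt (2 * x / 3))
     * ((4 * x) powr (4 * x) * 2 powr (4 * x)) \<le> 2 powr ((x / 2)\<^sup>2)) at_top"
  by real_asymp

text \<open>Place \<open>c\<close> in the lower half; adding \<open>b\<close> at both 0 and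
  \<open>M\<close> leaves the fold alone and sets the upper parity.\<close>

lemma exists_word_with_fold:
  assumes "\<And>i. i \<ge> M \<Longrightarrow> c i = 0" "M > 0"
  shows "\<exists>x\<in>carrier_vec (2 * M). fold_word M x = c \<and> upper_parity M x = b"
proof -
  define x where "x = vec (2 * M) (\<lambda>p. if p < M then c p + (if p = 0 then b else 0)
    else if p = M then b else 0)"
  have "fold_word M x = c" using assms by (auto simp: fold_word_def x_def fun_eq_iff add.assoc)
  moreover have "upper_parity M x = (\<Sum>i<M. if i = 0 then b else 0)"
    unfolding upper_parity_def by (intro sum.cong) (auto simp: x_def)
  ultimately show ?thesis using assms(2) by (intro bexI[of _ x]) (auto simp: x_def)
qed

text \<open>Upper parities of codewords with fold \<open>c\<close> reveal \<open>quad E c\<close>,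
  so a code determines its form on Hamming words.\<close>

lemma vasilev_code_eqD:
  assumes "vasilev_code k E = vasilev_code k E'" "ext_hamming k c" "\<And>i. i \<ge> 2 ^ k \<Longrightarrow> c i = 0"
  shows "quad E c = quad E' c"
proof -
  obtain x where x: "x \<in> carrier_vec (2 * 2 ^ k)" "fold_word (2 ^ k) x = c"
    "upper_parity (2 ^ k) x = quad E c"
    using exists_word_with_fold[of "2 ^ k" c "quad E c"] assms(3) by auto
  then have "x \<in> vasilev_code k E" using assms(2) by (simp add: vasilev_code_def)
  then have "x \<in> vasilev_code k E'" by (simp only: assms(1))
  then show ?thesis using x by (simp add: vasilev_code_def)
qed

text \<open>Correcting the word with ones at \<open>i\<close> and \<open>j\<close> by flips at 0 and
  some \<open>r\<close> changes it only in the lower half. These are the words that isolate single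
  monomials.\<close>

lemma ext_hamming_pair:
  assumes ij: "2 ^ k \<le> i" "i < 2 ^ Suc k" "2 ^ k \<le> j" "j < 2 ^ Suc k"
  shows "\<exists>c. ext_hamming (Suc k) c \<and> (\<forall>p\<ge>2 ^ Suc k. c p = 0) \<and>
    (\<forall>p\<ge>2 ^ k. c p = of_bool (p = i) + of_bool (p = j))"
proof -
  let ?d = "\<lambda>p. of_bool (p = i) + of_bool (p = j) :: bit"
  have "(\<Sum>p<2 ^ Suc k. ?d p) = 0"
    using sum_of_bool_eq[OF ij(2), of "\<lambda>_. 1"] sum_of_bool_eq[OF ij(4), of "\<lambda>_. 1"]
    by (simp only: sum.distrib mult_1_left bit_add_self)
  then obtain r where r: "r < 2 ^ Suc k"
    and ham: "ext_hamming (Suc k) (\<lambda>p. ?d p + of_bool (p = r) + of_bool (p = 0))"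
    using ext_hamming_correct[where k = "Suc k" and c = ?d and b = 0] by auto
  have top: "bit q k" if "2 ^ k \<le> q" "q < 2 ^ Suc k" for q :: nat
  proof -
    have "q div 2 ^ k = 1" using that by (intro div_nat_eqI) auto
    then show ?thesis by (simp add: bit_iff_odd)
  qed
  \<comment> \<open>In the check for the top bit \<open>k\<close>, the terms of \<open>i\<close> and
    \<open>j\<close> cancel and position 0 gives none, so \<open>r\<close> lacks that bit.\<close>
  have "(\<Sum>p<2 ^ Suc k. of_bool (bit p k) * (?d p + of_bool (p = r) + of_bool (p = 0))) = 0"
    using ham by (simp add: ext_hamming_def)
  then have "of_bool (bit i k) + of_bool (bit j k) + of_bool (bit r k) + of_bool (bit (0::nat) k) = (0::bit)"
    using ij r by (simp only: distrib_left sum.distrib sum_of_bool_eq zero_less_power pos2)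
  then have "\<not> bit r k" using top ij by auto
  then have "r < 2 ^ k" using top r not_less by blast
  then show ?thesis using ij r
    by (intro exI[of _ "\<lambda>p. ?d p + of_bool (p = r) + of_bool (p = 0)"] conjI ham) auto
qed

text \<open>On the word isolating \<open>i\<close> and \<open>j\<close>, disjointness of
  \<open>I\<close> and \<open>J\<close> leaves \<open>(i, j)\<close> as the only monomial that can
  be nonzero. The value of the form is therefore its coefficient.\<close>

lemma inj_on_vasilev_code:
  assumes I: "I \<subseteq> {2 ^ k..<2 ^ Suc k}" and J: "J \<subseteq> {2 ^ k..<2 ^ Suc k}" and disj: "I \<inter> J = {}"
  shows "inj_on (vasilev_code (Suc k)) (Pow (I \<times> J))"
proof (rule inj_onI)
  fix E E' assume E: "E \<in> Pow (I \<times> J)" "E' \<in> Pow (I \<times> J)"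
    and eq: "vasilev_code (Suc k) E = vasilev_code (Suc k) E'"
  have fin: "finite (I \<times> J)" using I J finite_subset by blast
  have "(i, j) \<in> E \<longleftrightarrow> (i, j) \<in> E'" if ij: "i \<in> I" "j \<in> J" for i j
  proof -
    have "2 ^ k \<le> i" "i < 2 ^ Suc k" "2 ^ k \<le> j" "j < 2 ^ Suc k" using ij I J by auto
    then obtain c where c: "ext_hamming (Suc k) c" "\<And>p. p \<ge> 2 ^ Suc k \<Longrightarrow> c p = 0"
      "\<And>p. p \<ge> 2 ^ k \<Longrightarrow> c p = of_bool (p = i) + of_bool (p = j)"
      using ext_hamming_pair by blast
    have "quad F c = of_bool ((i, j) \<in> F)" if F: "F \<subseteq> I \<times> J" for F
    proof -
      have "quad F c = (\<Sum>e\<in>F. if e = (i, j) then 1 else 0)"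
        unfolding quad_def
      proof (intro sum.cong refl)
        fix e assume "e \<in> F"
        then obtain a b where "e = (a, b)" "a \<in> I" "b \<in> J" using F by auto
        moreover have "a \<noteq> j" "b \<noteq> i" "a \<ge> 2 ^ k" "b \<ge> 2 ^ k" using calculation ij I J disj by auto
        ultimately show "(case e of (a, b) \<Rightarrow> c a * c b) = (if e = (i, j) then 1 else 0)"
          using c(3) by auto
      qed
      also have "\<dots> = of_bool ((i, j) \<in> F)" using finite_subset[OF F fin] by simp
      finally show ?thesis .
    qed
    then have "(of_bool ((i, j) \<in> E) :: bit) = of_bool ((i, j) \<in> E')"
      using vasilev_code_eqD[OF eq c(1,2)] E by auto
    then show ?thesis by (cases "(i, j) \<in> E"; cases "(i, j) \<in> E'") simp_all
  qed
  then show "E = E'" using E by auto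
qed

section \<open>Counting inequivalent codes\<close>

lemma many_inequivalent_codes:
  fixes k :: nat
  defines "n \<equiv> 2 ^ Suc k"
  shows "\<exists>S. finite S \<and> (\<forall>C\<in>S. propelinear (4 * n) C \<and> extended_perfect_code (4 * n) C) \<and>
    pairwise (\<lambda>C D. \<not> equivalent_codes (4 * n) C D) S \<and>
    2 ^ ((2 ^ k)\<^sup>2) \<le> fact (4 * n) * 2 ^ (4 * n) * card S"
proof -
  \<comment> \<open>Folds have length \<open>2 * n\<close>; \<open>I\<close> and \<open>J\<close>
    split their upper half into blocks of size \<open>2 ^ k\<close>, giving
    \<open>(2 ^ k)\<^sup>2\<close> monomials.\<close>
  define I where "I = {n..<n + 2 ^ k}"
  define J where "J = {n + 2 ^ k..<2 * n}"
  define T where "T = vasilev_code (Suc (Suc k)) ` Pow (I \<times> J)"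
  have IJ: "I \<subseteq> {2 ^ Suc k..<2 ^ Suc (Suc k)}" "J \<subseteq> {2 ^ Suc k..<2 ^ Suc (Suc k)}" "I \<inter> J = {}"
    by (auto simp: I_def J_def n_def)
  have len: "2 * 2 ^ Suc (Suc k) = 4 * n" by (simp add: n_def)
  have "card T = 2 ^ ((2 ^ k)\<^sup>2)"
    unfolding T_def card_image[OF inj_on_vasilev_code[OF IJ]]
    by (simp add: card_Pow card_cartesian_product I_def J_def n_def power2_eq_square)
  moreover have finT: "finite T" by (simp add: T_def I_def J_def)
  moreover have carr: "C \<subseteq> carrier_vec (4 * n)" if "C \<in> T" for C
    using that unfolding len[symmetric] T_def vasilev_code_def by blast
  moreover have "card {D \<in> T. equivalent_codes (4 * n) C D} \<le> fact (4 * n) * 2 ^ (4 * n)" for C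
    by (rule order_trans[OF card_mono card_equivalent_codes(2)[of "4 * n" C]])
      (auto simp: card_equivalent_codes)
  ultimately have "\<exists>S\<subseteq>T. pairwise (\<lambda>C D. \<not> equivalent_codes (4 * n) C D) S \<and>
    2 ^ ((2 ^ k)\<^sup>2) \<le> fact (4 * n) * 2 ^ (4 * n) * card S"
    using exists_pairwise_inequivalent[OF finT, of "equivalent_codes (4 * n)" "fact (4 * n) * 2 ^ (4 * n)",
      OF equivalent_codes_refl[OF carr] equivalent_codes_sym[OF _ carr]] by simp
  then obtain S where S: "S \<subseteq> T" "pairwise (\<lambda>C D. \<not> equivalent_codes (4 * n) C D) S"
    "2 ^ ((2 ^ k)\<^sup>2) \<le> fact (4 * n) * 2 ^ (4 * n) * card S" by blast
  have "propelinear (4 * n) C \<and> extended_perfect_code (4 * n) C" if C: "C \<in> T" for C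
  proof -
    obtain E where E: "E \<subseteq> I \<times> J" and C: "C = vasilev_code (Suc (Suc k)) E"
      using C by (auto simp: T_def)
    have "E \<subseteq> {..<2 ^ Suc (Suc k)} \<times> {..<2 ^ Suc (Suc k)}"
      using IJ(1,2) by (intro order_trans[OF E] Sigma_mono) auto
    then have "propelinear (2 * 2 ^ Suc (Suc k)) C" unfolding C by (rule vasilev_code_propelinear)
    moreover have "extended_perfect_code (2 * 2 ^ Suc (Suc k)) C"
      unfolding C by (rule vasilev_code_extended_perfect) simp
    ultimately show ?thesis unfolding len ..
  qed
  then have "\<forall>C\<in>S. propelinear (4 * n) C \<and> extended_perfect_code (4 * n) C" using S(1) by auto
  then show ?thesis using S finite_subset[OF S(1) finT] by (intro exI[of _ S] conjI)
qed

theorem corollary14: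
  shows "\<exists>\<epsilon> :: nat \<Rightarrow> real. \<epsilon> \<longlonglongrightarrow> 0 \<and>
    (\<forall>n :: nat. (\<exists>k :: nat. n = 2 ^ k) \<longrightarrow>
      (\<exists>S :: bit vec set set.
        finite S \<and>
        (\<forall>C\<in>S. propelinear (4 * n) C \<and> extended_perfect_code (4 * n) C) \<and>
        pairwise (\<lambda>C D. \<not> equivalent_codes (4 * n) C D) S \<and>
        real (card S) \<ge>
          1 / (8 * (real n)\<^sup>2 * sqrt 3) * exp (pi * sqrt (2 * real n / 3)) * (1 + \<epsilon> n)))"
proof -
  define b :: "nat \<Rightarrow> real" where
    "b n = 1 / (8 * (real n)\<^sup>2 * sqrt 3) * exp (pi * sqrt (2 * real n / 3))" for n
  \<comment> \<open>The condition \<open>n > 1\<close> makes a power of 2 even, so that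
    \<open>n / 2\<close> is the block size \<open>2 ^ k\<close>.\<close>
  define G where "G n \<longleftrightarrow> n > 1 \<and>
    b n * ((4 * real n) powr (4 * real n) * 2 powr (4 * real n)) \<le> 2 powr ((real n / 2)\<^sup>2)" for n
  define \<epsilon> :: "nat \<Rightarrow> real" where "\<epsilon> n = (if G n then 0 else - 1)" for n
  have "eventually G sequentially"
    unfolding G_def b_def
    using eventually_compose_filterlim[OF growth_comparison filterlim_real_sequentially]
      eventually_gt_at_top[of 1] by (rule eventually_conj[rotated])
  then have "\<epsilon> \<longlonglongrightarrow> 0"
    by (intro tendsto_eventually) (auto simp: \<epsilon>_def elim: eventually_mono)
  moreover have "\<exists>S :: bit vec set set. finite S \<and>
      (\<forall>C\<in>S. propelinear (4 * n) C \<and> extended_perfect_code (4 * n) C) \<and>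
      pairwise (\<lambda>C D. \<not> equivalent_codes (4 * n) C D) S \<and> real (card S) \<ge> b n * (1 + \<epsilon> n)"
    if n: "\<exists>k :: nat. n = 2 ^ k" for n
  proof (cases "G n")
    case False
    then show ?thesis by (intro exI[of _ "{}"]) (simp add: \<epsilon>_def)
  next
    case True
    from n obtain k' where "n = 2 ^ k'" by blast
    moreover have "n > 1" using True by (simp add: G_def)
    ultimately obtain k where k: "n = 2 ^ Suc k" by (cases k') auto
    obtain S where S: "finite S" "\<forall>C\<in>S. propelinear (4 * n) C \<and> extended_perfect_code (4 * n) C"
      "pairwise (\<lambda>C D. \<not> equivalent_codes (4 * n) C D) S"
      "2 ^ ((2 ^ k)\<^sup>2) \<le> fact (4 * n) * 2 ^ (4 * n) * card S"
      using many_inequivalent_codes[of k] unfolding k by blast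
    define K :: real where "K = fact (4 * n) * 2 ^ (4 * n)"
    have "K > 0" by (simp add: K_def)
    have "b n \<ge> 0" by (simp add: b_def)
    \<comment> \<open>The crude bound on the factorial matches the form used in
      \<open>growth_comparison\<close>.\<close>
    have "fact (4 * n) \<le> real ((4 * n) ^ (4 * n))" by (rule fact_le_power)
    also have "\<dots> = (4 * real n) powr (4 * real n)"
      using \<open>n > 1\<close> powr_realpow[of "4 * real n" "4 * n"] by simp
    finally have "K \<le> (4 * real n) powr (4 * real n) * 2 powr (4 * real n)"
      using powr_realpow[of 2 "4 * n"] by (simp add: K_def)
    then have "b n * K \<le> b n * ((4 * real n) powr (4 * real n) * 2 powr (4 * real n))"
      using \<open>b n \<ge> 0\<close> by (rule mult_left_mono)
    also have "\<dots> \<le> 2 powr ((real n / 2)\<^sup>2)" using True by (simp add: G_def)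
    also have "(real n / 2)\<^sup>2 = real ((2 ^ k)\<^sup>2)" by (simp add: k)
    also have "2 powr \<dots> = real (2 ^ ((2 ^ k)\<^sup>2))" by (subst powr_realpow) simp_all
    also have "\<dots> \<le> real (fact (4 * n) * 2 ^ (4 * n) * card S)" using S(4) of_nat_mono by blast
    also have "\<dots> = card S * K" by (simp add: K_def)
    finally have "b n \<le> card S" using \<open>K > 0\<close> by simp
    then show ?thesis using S True by (intro exI[of _ S]) (simp add: \<epsilon>_def)
  qed
  ultimately show ?thesis unfolding b_def by blast
qed

end
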